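(* Let $m \geq 1$ be an integer. Then there exists a prime in the open interval $(m^2, (m+1)^2)$ if and only if the sequence of consecutive integers $m^2+1, m^2+2, \ldots, m^2+2m$ is a W sequence.
   Context: Definition (W sequence): for an integer $n > 1$, a sequence of integers $0 < a_1 < a_2 < \cdots < a_n$ is called a W sequence if there exists an index $r$ with $1 \leq r \leq n$ such that $\gcd(a_r, a_j) = 1$ for every $j \in \{1, \ldots, n\}$ with $j \neq r$. *)

theory Defs
  imports Complex_Main "HOL-Computational_Algebra.Primes"
begin

text \<open>
  A finite sequence \<open>a\<^sub>1, \<dots>, a\<^sub>n\<close> is given by its length \<open>n\<close> and a function \<open>a\<close>;
  only the values of \<open>a\<close> on \<open>{1..n}\<close> matter. Given strict monotonicity, \<open>0 < a 1\<close>
  makes all terms positive.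
\<close>

definition W_sequence :: "nat \<Rightarrow> (nat \<Rightarrow> int) \<Rightarrow> bool" where
  "W_sequence n a \<longleftrightarrow>
     n > 1 \<and> 0 < a 1 \<and> strict_mono_on {1..n} a \<and>
     (\<exists>r\<in>{1..n}. \<forall>j\<in>{1..n}. j \<noteq> r \<longrightarrow> gcd (a r) (a j) = 1)"

end

theory Submission
  imports Defs
begin

text \<open>
  Write \<open>a\<^sub>i = m\<^sup>2 + i\<close> for \<open>1 \<le> i \<le> 2m\<close>; these are exactly the integers strictly between \<open>m\<^sup>2\<close>
  and \<open>(m + 1)\<^sup>2\<close>. The equivalence holds because this block has the right length on both sides.

  It is short compared with its entries: two distinct entries differ by less than \<open>2m \<le> m\<^sup>2 + 1\<close>,
  so a prime entry cannot divide another entry and is therefore coprime to all of them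
  (\<open>prime_coprime_nearby\<close>).

  It is long compared with the small divisors of its entries: a composite entry is below
  \<open>(m + 1)\<^sup>2\<close>, so it has a divisor \<open>d\<close> with \<open>1 < d \<le> m\<close> (\<open>composite_divisor_le_sqrt\<close>). From any
  position in a block of length \<open>2m\<close>, one can step by \<open>d \<le> m\<close> either to the right or to the left
  without leaving the block (\<open>step_within_block\<close>), which reaches another entry divisible by \<open>d\<close>.
  Hence an entry coprime to all the others must be prime.
\<close>

lemma prime_coprime_nearby:
  fixes p k :: nat
  assumes "prime p" "k \<noteq> p" "k < p + p" "0 < k"
  shows "coprime p k"
proof -
  have "\<not> p dvd k"
  proof
    assume "p dvd k"
    then obtain c where c: "k = p * c" ..
    with assms have "c \<noteq> 0" "c \<noteq> 1" by auto
    then have "p * 2 \<le> p * c" by (intro mult_le_mono2) linarith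
    with c assms(3) show False by simp
  qed
  with assms(1) show ?thesis by (rule prime_imp_coprime)
qed

text \<open>The smaller of two complementary proper divisors is at most the square root.\<close>

lemma composite_divisor_le_sqrt:
  fixes n m :: nat
  assumes "1 < n" "\<not> prime n" "n < (m + 1)\<^sup>2"
  obtains d where "d dvd n" "1 < d" "d \<le> m"
proof -
  obtain d where d: "d dvd n" "d \<noteq> 1" "d \<noteq> n"
    using assms(1,2) by (auto simp: prime_nat_iff)
  then obtain e where e: "n = d * e" by blast
  with d assms(1) have gt: "1 < d" "1 < e"
    by (auto simp: nat_neq_iff)
  have "min d e * min d e \<le> n"
    unfolding e by (intro mult_le_mono) auto
  with assms(3) have "(min d e)\<^sup>2 < (m + 1)\<^sup>2" by (simp add: power2_eq_square)
  then have "min d e < m + 1" by (rule power_less_imp_less_base) simp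
  moreover have "min d e dvd n" unfolding e by (auto simp: min_def)
  ultimately show thesis using gt that[of "min d e"] by auto
qed

text \<open>
  Each half of the block has length \<open>m\<close>, so from the left half a step to the right stays inside,
  and from the right half a step to the left does.
\<close>

lemma step_within_block:
  fixes r d m :: nat
  assumes "r \<in> {1..2 * m}" "0 < d" "d \<le> m"
  obtains j where "j \<in> {1..2 * m}" "j = r + d \<or> r = j + d"
proof (cases "r \<le> m")
  case True
  with assms show thesis by (intro that[of "r + d"]) auto
next
  case False
  with assms show thesis by (intro that[of "r - d"]) auto
qed

lemma prime_iff_coprime_to_block:
  fixes m r :: nat
  assumes r: "r \<in> {1..2 * m}"
  shows "prime (m\<^sup>2 + r) \<longleftrightarrow> (\<forall>j\<in>{1..2 * m}. j \<noteq> r \<longrightarrow> coprime (m\<^sup>2 + r) (m\<^sup>2 + j))"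
proof (intro iffI ballI impI)
  fix j assume p: "prime (m\<^sup>2 + r)" and j: "j \<in> {1..2 * m}" "j \<noteq> r"
  \<comment> \<open>This is \<open>0 \<le> (m - 1)\<^sup>2\<close>, rearranged to avoid truncated subtraction.\<close>
  have "real (2 * m) \<le> real (m\<^sup>2 + 1)"
    using sum_squares_bound[of "real m" 1] by simp
  then have "2 * m \<le> m\<^sup>2 + 1" by (simp only: of_nat_le_iff)
  with r j have "m\<^sup>2 + j < (m\<^sup>2 + r) + (m\<^sup>2 + r)" by auto
  with p j show "coprime (m\<^sup>2 + r) (m\<^sup>2 + j)" by (intro prime_coprime_nearby) auto
next
  assume cop: "\<forall>j\<in>{1..2 * m}. j \<noteq> r \<longrightarrow> coprime (m\<^sup>2 + r) (m\<^sup>2 + j)"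
  show "prime (m\<^sup>2 + r)"
  proof (rule ccontr)
    assume "\<not> prime (m\<^sup>2 + r)"
    moreover have "1 < m\<^sup>2 + r"
    proof -
      have "1 \<le> r" "0 < m\<^sup>2" using r by auto
      then show ?thesis by linarith
    qed
    moreover have "m\<^sup>2 + r < (m + 1)\<^sup>2" using r by (auto simp: power2_eq_square)
    ultimately obtain d where d: "d dvd m\<^sup>2 + r" "1 < d" "d \<le> m"
      using composite_divisor_le_sqrt by blast
    then obtain j where j: "j \<in> {1..2 * m}" "j = r + d \<or> r = j + d"
      using step_within_block[OF r] by (metis less_trans zero_less_one)
    from j(2) have "d dvd m\<^sup>2 + j"
    proof
      assume "j = r + d"
      then have "m\<^sup>2 + j = (m\<^sup>2 + r) + d" by simp
      with d(1) show ?thesis by (metis dvd_add dvd_refl)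
    next
      assume "r = j + d"
      then have "m\<^sup>2 + r = (m\<^sup>2 + j) + d" by simp
      with d(1) show ?thesis by (metis dvd_add_left_iff dvd_refl)
    qed
    moreover have "coprime (m\<^sup>2 + r) (m\<^sup>2 + j)" using cop j d(2) by auto
    ultimately have "is_unit d" using d(1) coprime_common_divisor by blast
    with d(2) show False by simp
  qed
qed

theorem theorem2:
  fixes m :: nat
  assumes "m \<ge> 1"
  shows "(\<exists>p::nat. prime p \<and> p \<in> {m ^ 2<..<(m + 1) ^ 2}) \<longleftrightarrow>
         W_sequence (2 * m) (\<lambda>i. int (m ^ 2 + i))"
proof -
  have "(\<exists>p. prime p \<and> p \<in> {m\<^sup>2<..<(m + 1)\<^sup>2}) \<longleftrightarrow> (\<exists>r\<in>{1..2 * m}. prime (m\<^sup>2 + r))"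
  proof
    assume "\<exists>p. prime p \<and> p \<in> {m\<^sup>2<..<(m + 1)\<^sup>2}"
    then obtain p where "prime p" "m\<^sup>2 < p" "p < (m + 1)\<^sup>2" by auto
    then show "\<exists>r\<in>{1..2 * m}. prime (m\<^sup>2 + r)"
      by (intro bexI[of _ "p - m\<^sup>2"]) (auto simp: power2_eq_square)
  next
    assume "\<exists>r\<in>{1..2 * m}. prime (m\<^sup>2 + r)"
    then obtain r where "r \<in> {1..2 * m}" "prime (m\<^sup>2 + r)" by blast
    then show "\<exists>p. prime p \<and> p \<in> {m\<^sup>2<..<(m + 1)\<^sup>2}"
      by (intro exI[of _ "m\<^sup>2 + r"]) (auto simp: power2_eq_square)
  qed
  also have "\<dots> \<longleftrightarrow>
      (\<exists>r\<in>{1..2 * m}. \<forall>j\<in>{1..2 * m}. j \<noteq> r \<longrightarrow> coprime (m\<^sup>2 + r) (m\<^sup>2 + j))"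
    using prime_iff_coprime_to_block by blast
  also have "\<dots> \<longleftrightarrow> W_sequence (2 * m) (\<lambda>i. int (m\<^sup>2 + i))"
  proof -
    have "gcd (int a) (int b) = 1 \<longleftrightarrow> coprime a b" for a b
      by (simp add: coprime_iff_gcd_eq_1 flip: coprime_int_iff)
    moreover have "strict_mono_on {1..2 * m} (\<lambda>i. int (m\<^sup>2 + i))"
      by (auto intro: strict_mono_onI)
    moreover have "1 < 2 * m" using assms by simp
    moreover have "0 < int (m\<^sup>2 + 1)" by (simp only: of_nat_0_less_iff)
    ultimately show ?thesis unfolding W_sequence_def by presburger
  qed
  finally show ?thesis .
qed

end
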